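(* Let $(X,d)$ be a metric space and let $f$ be an unbounded modulus function such that $WS=WS^f$, where $WS$ and $WS^f$ are the classes of Wijsman statistically convergent and Wijsman $f$-statistically convergent sequences in $CL(X)$. Then $f$ is compatible.
   Context: $\mathbb{R}^+=[0,\infty)$. A modulus function is a function $f:\mathbb{R}^+\to\mathbb{R}^+$ such that: $f(x)=0$ if and only if $x=0$; $f(x+y)\le f(x)+f(y)$ for all $x,y\in\mathbb{R}^+$; $f$ is increasing; $f$ is continuous from the right at $0$. All modulus functions are assumed unbounded. $f$ is compatible if $\lim_{\varepsilon\to 0}\varphi(\varepsilon)=0$, where $\varphi(\varepsilon)=\limsup_{n\to\infty}\frac{f(n\varepsilon)}{f(n)}$ ($n\in\mathbb{N}$, $\varepsilon>0$). For the metric space $(X,d)$, $CL(X)$ is the family of all (nonempty) closed subsets of $X$, and $d(x,A)=\inf_{a\in A}d(x,a)$. $\#$ denotes cardinality. A real sequence $(x_k)_{k\ge1}$ is $f$-statistically convergent to $L$ if for every $\varepsilon>0$, $\lim_{n\to\infty}\frac{1}{f(n)}f(\#\{k\le n: |x_k-L|>\varepsilon\})=0$; it is statistically convergent to $L$ if for every $\varepsilon>0$, $\lim_{n\to\infty}\frac1n\#\{k\le n:|x_k-L|>\varepsilon\}=0$. $(A_k)_k\subset CL(X)$ is Wijsman $f$-statistically convergent (resp. Wijsman statistically convergent) to $A\in CL(X)$ if for every $x\in X$ the real sequence $(d(x,A_k))_k$ is $f$-statistically convergent (resp. statistically convergent) to $d(x,A)$. $WS^f$ (resp. $WS$) is the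 set of all sequences in $CL(X)$ that are Wijsman $f$-statistically convergent (resp. Wijsman statistically convergent) to some $A\in CL(X)$.
   Formalization: The metric space X is assumed to have at least two points; for a one-point X every sequence in CL(X) is constant, so WS = WS^f for every f, including the non-compatible unbounded modulus f(x) = log(1+x). *)

theory Defs
  imports "HOL-Analysis.Analysis"
begin

text \<open>A modulus function lives on \<open>[0,\<infinity>)\<close>; it is represented by a function on the reals of which
  only the values on \<open>{0..}\<close> are constrained or used. ``Increasing'' is read as nondecreasing.\<close>

definition modulus_function :: "(real \<Rightarrow> real) \<Rightarrow> bool" where
  "modulus_function f \<longleftrightarrow>
     (\<forall>x\<ge>0. f x \<ge> 0) \<and>
     (\<forall>x\<ge>0. f x = 0 \<longleftrightarrow> x = 0) \<and>
     (\<forall>x\<ge>0. \<forall>y\<ge>0. f (x + y) \<le> f x + f y) \<and>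
     mono_on {0..} f \<and>
     continuous (at_right 0) f"

definition unbounded_modulus :: "(real \<Rightarrow> real) \<Rightarrow> bool" where
  "unbounded_modulus f \<longleftrightarrow> modulus_function f \<and> \<not> bdd_above (f ` {0..})"

definition modulus_phi :: "(real \<Rightarrow> real) \<Rightarrow> real \<Rightarrow> ereal" where
  "modulus_phi f \<epsilon> = limsup (\<lambda>n. ereal (f (real n * \<epsilon>) / f (real n)))"

definition compatible :: "(real \<Rightarrow> real) \<Rightarrow> bool" where
  "compatible f \<longleftrightarrow> (modulus_phi f \<longlongrightarrow> 0) (at_right 0)"

text \<open>Sequences are indexed from 1; the value at index 0 is irrelevant throughout.\<close>

definition statistically_convergent :: "(nat \<Rightarrow> real) \<Rightarrow> real \<Rightarrow> bool" where
  "statistically_convergent x L \<longleftrightarrow>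
     (\<forall>\<epsilon>>0. (\<lambda>n. real (card {k\<in>{1..n}. \<bar>x k - L\<bar> > \<epsilon>}) / real n) \<longlonglongrightarrow> 0)"

definition f_statistically_convergent ::
  "(real \<Rightarrow> real) \<Rightarrow> (nat \<Rightarrow> real) \<Rightarrow> real \<Rightarrow> bool" where
  "f_statistically_convergent f x L \<longleftrightarrow>
     (\<forall>\<epsilon>>0. (\<lambda>n. f (real (card {k\<in>{1..n}. \<bar>x k - L\<bar> > \<epsilon>})) / f (real n)) \<longlonglongrightarrow> 0)"

definition CL :: "'a set \<Rightarrow> ('a \<Rightarrow> 'a \<Rightarrow> real) \<Rightarrow> 'a set set" where
  "CL X d = {A. closedin (Metric_space.mtopology X d) A \<and> A \<noteq> {}}"

definition dist_to_set :: "('a \<Rightarrow> 'a \<Rightarrow> real) \<Rightarrow> 'a \<Rightarrow> 'a set \<Rightarrow> real" where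
  "dist_to_set d x A = (INF a\<in>A. d x a)"

definition Wijsman_statistically_convergent ::
  "'a set \<Rightarrow> ('a \<Rightarrow> 'a \<Rightarrow> real) \<Rightarrow> (nat \<Rightarrow> 'a set) \<Rightarrow> 'a set \<Rightarrow> bool" where
  "Wijsman_statistically_convergent X d A B \<longleftrightarrow>
     (\<forall>x\<in>X. statistically_convergent (\<lambda>k. dist_to_set d x (A k)) (dist_to_set d x B))"

definition Wijsman_f_statistically_convergent ::
  "'a set \<Rightarrow> ('a \<Rightarrow> 'a \<Rightarrow> real) \<Rightarrow> (real \<Rightarrow> real) \<Rightarrow> (nat \<Rightarrow> 'a set) \<Rightarrow> 'a set \<Rightarrow> bool" where
  "Wijsman_f_statistically_convergent X d f A B \<longleftrightarrow>
     (\<forall>x\<in>X. f_statistically_convergent f (\<lambda>k. dist_to_set d x (A k)) (dist_to_set d x B))"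

text \<open>If \<open>X\<close> has at most one point, then \<open>CL X d\<close> has at most one element and the two classes
  below coincide for every modulus function \<open>f\<close>, compatible or not.\<close>

definition WS :: "'a set \<Rightarrow> ('a \<Rightarrow> 'a \<Rightarrow> real) \<Rightarrow> (nat \<Rightarrow> 'a set) set" where
  "WS X d = {A. (\<forall>k\<ge>1. A k \<in> CL X d) \<and>
     (\<exists>B\<in>CL X d. Wijsman_statistically_convergent X d A B)}"

definition WSf :: "'a set \<Rightarrow> ('a \<Rightarrow> 'a \<Rightarrow> real) \<Rightarrow> (real \<Rightarrow> real) \<Rightarrow> (nat \<Rightarrow> 'a set) set" where
  "WSf X d f = {A. (\<forall>k\<ge>1. A k \<in> CL X d) \<and>
     (\<exists>B\<in>CL X d. Wijsman_f_statistically_convergent X d f A B)}"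

end

(*
  If f is not compatible, there is c > 0 such that for every k infinitely many n satisfy
  f (n / 2^k) > c * f n. Pick such n = N k increasing in k and let E consist of the j that are
  divisible by 2^k whenever j > N k. Beyond N k the set E contains only multiples of 2^k, so it
  has density 0; up to N (k + 1) it contains all multiples of 2^k, so f (#E(n)) / f n exceeds c
  at n = N (k + 1). The sequence of singletons equal to {a} on E and to {b} off E then
  converges to {b} in the Wijsman statistical sense but has no Wijsman f-statistical limit.
*)
theory Submission
  imports Defs
begin

lemma modulus_function_nonneg: "modulus_function f \<Longrightarrow> x \<ge> 0 \<Longrightarrow> f x \<ge> 0"
  by (simp add: modulus_function_def)

lemma modulus_function_mono: "modulus_function f \<Longrightarrow> 0 \<le> x \<Longrightarrow> x \<le> y \<Longrightarrow> f x \<le> f y"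
  unfolding modulus_function_def by (auto intro: mono_onD)

lemma modulus_function_pos: "modulus_function f \<Longrightarrow> x > 0 \<Longrightarrow> f x > 0"
  unfolding modulus_function_def by (metis less_eq_real_def less_irrefl)

lemma modulus_function_double_le: "modulus_function f \<Longrightarrow> 0 \<le> x \<Longrightarrow> f (2 * x) \<le> 2 * f x"
  unfolding modulus_function_def by (metis mult_2)

text \<open>Since \<open>f\<close> is nondecreasing, a bound at the single scale
  \<open>1 / 2 ^ k\<close> holds for every smaller \<open>\<epsilon>\<close>, so it controls
  \<open>modulus_phi f\<close> on a whole right neighbourhood of 0. The criterion is used in
  contrapositive form: failure of compatibility yields one \<open>c\<close> that is exceeded
  infinitely often at every dyadic scale.\<close>

lemma compatibleI:
  assumes f: "modulus_function f"
    and small: "\<And>c. c > 0 \<Longrightarrow> \<exists>k. \<forall>\<^sub>F n in sequentially. f (real n / 2 ^ k) \<le> c * f (real n)"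
  shows "compatible f"
  unfolding compatible_def
proof (rule order_tendstoI)
  fix a :: ereal
  assume a: "a < 0"
  have "modulus_phi f \<epsilon> > a" if "\<epsilon> > 0" for \<epsilon>
  proof -
    have "0 \<le> modulus_phi f \<epsilon>"
      unfolding modulus_phi_def using that
      by (intro le_Limsup always_eventually) (auto simp: modulus_function_nonneg[OF f])
    with a show ?thesis by (rule less_le_trans)
  qed
  then show "\<forall>\<^sub>F \<epsilon> in at_right 0. a < modulus_phi f \<epsilon>"
    by (intro eventually_mono[OF eventually_at_right_less])
next
  fix a :: ereal
  assume "0 < a"
  \<comment> \<open>An intermediate \<open>c\<close> restores the strict inequality, as a limsup
    only inherits the non-strict bound \<open>c\<close>.\<close>
  then obtain c where c: "0 < ereal c" "ereal c < a"
    using ereal_dense2 by blast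
  then obtain k where k: "\<forall>\<^sub>F n in sequentially. f (real n / 2 ^ k) \<le> c * f (real n)"
    using small[of c] by auto
  have "modulus_phi f \<epsilon> < a" if \<epsilon>: "0 < \<epsilon>" "\<epsilon> < 1 / 2 ^ k" for \<epsilon>
  proof -
    have "\<forall>\<^sub>F n in sequentially. ereal (f (real n * \<epsilon>) / f (real n)) \<le> ereal c"
      using k eventually_gt_at_top[of 0]
    proof eventually_elim
      case (elim n)
      have "real n * \<epsilon> \<le> real n / 2 ^ k"
        using mult_left_mono[of \<epsilon> "1 / 2 ^ k" "real n"] \<epsilon> by simp
      then have "f (real n * \<epsilon>) \<le> c * f (real n)"
        using modulus_function_mono[OF f, of "real n * \<epsilon>" "real n / 2 ^ k"] \<epsilon> elim by simp
      then show ?case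
        using modulus_function_pos[OF f, of "real n"] elim by (simp add: divide_simps)
    qed
    then have "modulus_phi f \<epsilon> \<le> ereal c"
      unfolding modulus_phi_def by (rule Limsup_bounded)
    also note c(2)
    finally show ?thesis .
  qed
  then show "\<forall>\<^sub>F \<epsilon> in at_right 0. modulus_phi f \<epsilon> < a"
    unfolding eventually_at_right_field by (intro exI[of _ "1 / 2 ^ k"]) auto
qed

lemma card_multiples:
  assumes "m > 0"
  shows "card {j \<in> {1..n}. m dvd j} = n div (m::nat)"
proof -
  have "{j \<in> {1..n}. m dvd j} = (*) m ` {1..n div m}"
    using assms by (auto simp: less_eq_div_iff_mult_less_eq mult.commute elim!: dvdE)
  also have "card \<dots> = n div m"
    using assms by (subst card_image) (auto simp: inj_on_def)
  finally show ?thesis .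
qed

text \<open>Supplies the index set of the counterexample: negligible for ordinary density, but not
  for the density weighted by \<open>f\<close>.\<close>

lemma density_zero_not_f_density_zero:
  assumes f: "modulus_function f" and "\<not> compatible f"
  obtains E :: "nat set"
  where "(\<lambda>n. real (card (E \<inter> {1..n})) / real n) \<longlonglongrightarrow> 0"
    and "\<not> (\<lambda>n. f (real (card (E \<inter> {1..n}))) / f (real n)) \<longlonglongrightarrow> 0"
proof -
  obtain c where c: "c > 0"
    and ev: "\<And>k. \<not> (\<forall>\<^sub>F n in sequentially. f (real n / 2 ^ k) \<le> c * f (real n))"
    using assms compatibleI by blast
  \<comment> \<open>The clause \<open>2 ^ k \<le> n\<close> keeps integer quotients of
    \<open>n\<close> positive, which later controls rounding; \<open>m < n\<close> makes the chosen
    indices strictly increasing.\<close>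
  have frq: "\<exists>n. (2 ^ k \<le> n \<and> c * f (real n) < f (real n / 2 ^ k)) \<and> m < n" for k m
  proof -
    obtain n where "n \<ge> 2 ^ k + Suc m" "c * f (real n) < f (real n / 2 ^ k)"
      using ev[of k] unfolding eventually_sequentially by (meson not_le)
    then show ?thesis
      by (intro exI[of _ n]) auto
  qed
  obtain N where N: "\<And>k. 2 ^ k \<le> N k \<and> c * f (real (N k)) < f (real (N k) / 2 ^ k)"
    and step: "\<And>k. N k < N (Suc k)"
    using dependent_nat_choice[of "\<lambda>k n. 2 ^ k \<le> n \<and> c * f (real n) < f (real n / 2 ^ k)"
        "\<lambda>k m n. m < n"] frq by metis
  have mono: "strict_mono N"
    using step by (rule strict_monoI_Suc)
  \<comment> \<open>The moduli form a divisibility chain, so at each \<open>j\<close> only the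
    condition with the largest active index matters.\<close>
  define E where "E = {j. \<forall>k. N k < j \<longrightarrow> 2 ^ k dvd j}"
  have upper: "card (E \<inter> {1..n}) \<le> N k + n div 2 ^ k" for n k
  proof -
    have "card (E \<inter> {1..n}) \<le> card ({1..N k} \<union> {j \<in> {1..n}. 2 ^ k dvd j})"
      by (rule card_mono) (auto simp: E_def)
    also have "\<dots> \<le> N k + n div 2 ^ k"
      using card_Un_le[of "{1..N k}" "{j \<in> {1..n}. 2 ^ k dvd j}"]
      unfolding card_multiples[OF zero_less_power[OF pos2]] by simp
    finally show ?thesis .
  qed
  \<comment> \<open>For \<open>j\<close> up to \<open>N (Suc k)\<close> only conditions with index
    at most \<open>k\<close> are active, and each \<open>2 ^ i\<close> with \<open>i \<le> k\<close>
    divides \<open>2 ^ k\<close>.\<close>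
  have lower: "N (Suc k) div 2 ^ k \<le> card (E \<inter> {1..N (Suc k)})" for k
  proof -
    have "{j \<in> {1..N (Suc k)}. 2 ^ k dvd j} \<subseteq> E \<inter> {1..N (Suc k)}"
    proof (auto simp: E_def)
      fix j i assume j: "j \<le> N (Suc k)" "2 ^ k dvd j" "N i < j"
      then have "N i < N (Suc k)" by simp
      then have "i \<le> k" using strict_mono_less[OF mono] by simp
      then show "2 ^ i dvd j" using j(2) by (meson dvd_trans le_imp_power_dvd)
    qed
    then have "card {j \<in> {1..N (Suc k)}. 2 ^ k dvd j} \<le> card (E \<inter> {1..N (Suc k)})"
      by (intro card_mono) auto
    then show ?thesis unfolding card_multiples[OF zero_less_power[OF pos2]] .
  qed
  have "(\<lambda>n. real (card (E \<inter> {1..n})) / real n) \<longlonglongrightarrow> 0"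
  proof (rule order_tendstoI)
    fix a :: real
    assume "a < 0"
    then show "\<forall>\<^sub>F n in sequentially. a < real (card (E \<inter> {1..n})) / real n"
      by (intro always_eventually allI) (rule less_le_trans, auto)
  next
    fix a :: real
    assume a: "0 < a"
    \<comment> \<open>The margin \<open>a\<close> is split in two: the multiples of
      \<open>2 ^ k\<close> contribute less than \<open>a / 2\<close>, and so does the initial
      segment of length \<open>N k\<close> once \<open>n\<close> exceeds
      \<open>2 * N k / a\<close>.\<close>
    obtain k where k: "(1 / 2) ^ k < a / 2"
      using real_arch_pow_inv[of "a / 2" "1 / 2"] a by auto
    have "\<forall>\<^sub>F n in sequentially. real n > 2 * real (N k) / a"
      using filterlim_real_sequentially unfolding filterlim_at_top_dense by blast
    then show "\<forall>\<^sub>F n in sequentially. real (card (E \<inter> {1..n})) / real n < a"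
      using eventually_gt_at_top[of 0]
    proof eventually_elim
      case (elim n)
      have "real (card (E \<inter> {1..n})) \<le> real (N k) + real (n div 2 ^ k)"
        using upper[of n k] by linarith
      also have "real (n div 2 ^ k) \<le> real n * (1 / 2) ^ k"
        using of_nat_div_le_of_nat[of n "2 ^ k", where ?'a = real] by (simp add: power_divide)
      also have "real n * (1 / 2) ^ k \<le> real n * (a / 2)"
        using k by (intro mult_left_mono) auto
      finally have "real (card (E \<inter> {1..n})) \<le> real (N k) + real n * (a / 2)" by simp
      also have "\<dots> < real n * a"
        using elim a by (simp add: field_simps)
      finally show ?case using elim by (simp add: divide_simps mult.commute)
    qed
  qed
  moreover have "\<not> (\<lambda>n. f (real (card (E \<inter> {1..n}))) / f (real n)) \<longlonglongrightarrow> 0"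
  proof
    assume lim: "(\<lambda>n. f (real (card (E \<inter> {1..n}))) / f (real n)) \<longlonglongrightarrow> 0"
    \<comment> \<open>Along this subsequence the quotients stay above \<open>c\<close>, which
      contradicts a limit of 0.\<close>
    have "strict_mono (\<lambda>k. N (Suc k))"
      using step by (intro strict_monoI_Suc)
    from LIMSEQ_subseq_LIMSEQ[OF lim this]
    have "(\<lambda>k. f (real (card (E \<inter> {1..N (Suc k)}))) / f (real (N (Suc k)))) \<longlonglongrightarrow> 0"
      by (simp add: o_def)
    then obtain k where
      k: "f (real (card (E \<inter> {1..N (Suc k)}))) / f (real (N (Suc k))) < c"
      using order_tendstoD(2)[OF _ c] eventually_happens'[OF sequentially_bot] by blast
    define n where "n = N (Suc k)"
    have n: "2 ^ Suc k \<le> n" "c * f (real n) < f (real n / 2 ^ Suc k)"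
      using N unfolding n_def by blast+
    \<comment> \<open>The choice of \<open>N\<close> bounds \<open>f\<close> at
      \<open>n / 2 ^ Suc k\<close>, while \<open>E\<close> has at least \<open>n div 2 ^ k\<close>
      elements up to \<open>n\<close>. The spare factor 2 absorbs the rounding: with
      \<open>q = n div 2 ^ k\<close> at least 1,
      \<open>n < 2 ^ k * (q + 1) \<le> 2 ^ Suc k * q\<close>.\<close>
    have "n < 2 ^ k * (n div 2 ^ k) + 2 ^ k"
      by (metis add.commute add_less_cancel_left div_mult_mod_eq mod_less_divisor mult.commute
          pos2 zero_less_power)
    moreover have "1 \<le> n div 2 ^ k"
      using n(1) by (simp add: Suc_le_eq div_greater_zero_iff)
    then have "2 ^ k * 1 \<le> 2 ^ k * (n div 2 ^ k)"
      by (intro mult_left_mono) auto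
    ultimately have "n \<le> 2 ^ Suc k * (n div 2 ^ k)"
      unfolding power_Suc mult.assoc by linarith
    then have "real n \<le> 2 ^ Suc k * real (n div 2 ^ k)"
      by (metis of_nat_le_iff of_nat_mult of_nat_numeral of_nat_power)
    then have "real n / 2 ^ Suc k \<le> real (n div 2 ^ k)"
      by (simp add: divide_simps mult.commute)
    also have "\<dots> \<le> real (card (E \<inter> {1..n}))"
      using lower[of k] unfolding n_def by simp
    finally have "f (real n / 2 ^ Suc k) \<le> f (real (card (E \<inter> {1..n})))"
      by (intro modulus_function_mono[OF f]) auto
    then have "c * f (real n) < f (real (card (E \<inter> {1..n})))"
      using n(2) by linarith
    moreover have "0 < n"
      using n(1) by (metis less_le_trans pos2 zero_less_power)
    then have "f (real n) > 0"
      by (intro modulus_function_pos[OF f]) simp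
    ultimately show False
      using k unfolding n_def[symmetric] by (simp add: divide_simps)
  qed
  ultimately show thesis by (rule that)
qed

text \<open>Eventually the complement of \<open>E\<close> fills at least half of
  \<open>{1..n}\<close>, and subadditivity turns half of the points into at least half of
  \<open>f n\<close>.\<close>

lemma f_density_ge_half:
  assumes f: "modulus_function f"
    and E: "(\<lambda>n. real (card (E \<inter> {1..n})) / real n) \<longlonglongrightarrow> 0"
  shows "\<forall>\<^sub>F n in sequentially. f (real (card ({1..n} - E))) / f (real n) \<ge> 1 / 2"
proof -
  have "\<forall>\<^sub>F n in sequentially. real (card (E \<inter> {1..n})) / real n < 1 / 2"
    using E by (rule order_tendstoD) simp
  then show ?thesis
    using eventually_gt_at_top[of 0]
  proof eventually_elim
    case (elim n)
    have "card (E \<inter> {1..n}) + card ({1..n} - E) = n"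
      using card_Int_Diff[of "{1..n}" E] by (simp add: Int_commute)
    then have "real n \<le> 2 * real (card ({1..n} - E))"
      using elim by (simp add: field_simps)
    then have "f (real n) \<le> f (2 * real (card ({1..n} - E)))"
      by (intro modulus_function_mono[OF f]) auto
    also have "\<dots> \<le> 2 * f (real (card ({1..n} - E)))"
      by (intro modulus_function_double_le[OF f]) auto
    finally show ?case
      using modulus_function_pos[OF f, of "real n"] elim by (simp add: divide_simps)
  qed
qed

lemma statistically_convergentI:
  assumes E: "(\<lambda>n. real (card (E \<inter> {1..n})) / real n) \<longlonglongrightarrow> 0"
    and off: "\<And>k. k \<notin> E \<Longrightarrow> x k = L"
  shows "statistically_convergent x L"
  unfolding statistically_convergent_def
proof (intro allI impI)
  fix \<epsilon> :: real
  assume "\<epsilon> > 0"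
  then have "card {k \<in> {1..n}. \<bar>x k - L\<bar> > \<epsilon>} \<le> card (E \<inter> {1..n})" for n
    using off by (intro card_mono) force+
  then show "(\<lambda>n. real (card {k \<in> {1..n}. \<bar>x k - L\<bar> > \<epsilon>}) / real n) \<longlonglongrightarrow> 0"
    by (intro tendsto_sandwich[OF _ _ tendsto_const E] always_eventually)
      (auto intro!: divide_right_mono)
qed

text \<open>Every candidate limit has to be excluded. If \<open>L = v\<close>, the exceptional set
  at half the distance from \<open>u\<close> to \<open>v\<close> is exactly \<open>E\<close>. If
  \<open>L\<close> differs from \<open>v\<close>, the exceptional set at half the distance from
  \<open>v\<close> to \<open>L\<close> contains the complement of \<open>E\<close>, whose weighted
  density is eventually at least 1/2.\<close>

lemma not_f_statistically_convergent:
  assumes f: "modulus_function f"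
    and E: "(\<lambda>n. real (card (E \<inter> {1..n})) / real n) \<longlonglongrightarrow> 0"
    and fE: "\<not> (\<lambda>n. f (real (card (E \<inter> {1..n}))) / f (real n)) \<longlonglongrightarrow> 0"
    and "u \<noteq> v"
  shows "\<not> f_statistically_convergent f (\<lambda>k. if k \<in> E then u else v) L"
proof
  let ?x = "\<lambda>k. if k \<in> E then u else v"
  assume "f_statistically_convergent f ?x L"
  then have lim: "(\<lambda>n. f (real (card {k \<in> {1..n}. \<bar>?x k - L\<bar> > \<epsilon>})) / f (real n)) \<longlonglongrightarrow> 0"
    if "\<epsilon> > 0" for \<epsilon>
    using that unfolding f_statistically_convergent_def by blast
  show False
  proof (cases "L = v")
    case True
    then have "{k \<in> {1..n}. \<bar>?x k - L\<bar> > \<bar>u - v\<bar> / 2} = E \<inter> {1..n}" for n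
      using \<open>u \<noteq> v\<close> by auto
    then show False
      using lim[of "\<bar>u - v\<bar> / 2"] fE \<open>u \<noteq> v\<close> by simp
  next
    case False
    define S where "S n = {k \<in> {1..n}. \<bar>?x k - L\<bar> > \<bar>v - L\<bar> / 2}" for n
    have "\<forall>\<^sub>F n in sequentially. f (real (card (S n))) / f (real n) < 1 / 2"
      using lim[of "\<bar>v - L\<bar> / 2"] False unfolding S_def by (intro order_tendstoD(2)) auto
    then have "\<forall>\<^sub>F n in sequentially. False"
      using f_density_ge_half[OF f E]
    proof eventually_elim
      case (elim n)
      have "card ({1..n} - E) \<le> card (S n)"
        using False unfolding S_def by (intro card_mono) auto
      then have "f (real (card ({1..n} - E))) / f (real n) \<le> f (real (card (S n))) / f (real n)"
        by (intro divide_right_mono modulus_function_mono[OF f] modulus_function_nonneg[OF f]) auto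
      with elim show ?case by linarith
    qed
    then show False by simp
  qed
qed

lemma singleton_in_CL:
  assumes "Metric_space X d" "a \<in> X"
  shows "{a} \<in> CL X d"
proof -
  interpret Metric_space X d by fact
  show ?thesis
    using assms(2) Hausdorff_space_mtopology closedin_Hausdorff_singleton[of mtopology a]
    by (simp add: CL_def)
qed

theorem theorem2p4:
  fixes X :: "'a set" and d :: "'a \<Rightarrow> 'a \<Rightarrow> real" and f :: "real \<Rightarrow> real"
  assumes "Metric_space X d"
    and "\<exists>a\<in>X. \<exists>b\<in>X. a \<noteq> b"
    and "unbounded_modulus f"
    and "WS X d = WSf X d f"
  shows "compatible f"
proof (rule ccontr)
  assume "\<not> compatible f"
  have f: "modulus_function f"
    using assms(3) by (simp add: unbounded_modulus_def)
  obtain E where E: "(\<lambda>n. real (card (E \<inter> {1..n})) / real n) \<longlonglongrightarrow> 0"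
    and fE: "\<not> (\<lambda>n. f (real (card (E \<inter> {1..n}))) / f (real n)) \<longlonglongrightarrow> 0"
    using density_zero_not_f_density_zero[OF f \<open>\<not> compatible f\<close>] by blast
  obtain a b where ab: "a \<in> X" "b \<in> X" "a \<noteq> b"
    using assms(2) by blast
  \<comment> \<open>With singletons the distance from any \<open>x\<close> to \<open>A k\<close>
    takes just the two values \<open>d x a\<close> and \<open>d x b\<close>, which reduces the set
    problem to a two-valued real sequence.\<close>
  define A where "A k = (if k \<in> E then {a} else {b})" for k :: nat
  have dist: "(\<lambda>k. dist_to_set d x (A k)) = (\<lambda>k. if k \<in> E then d x a else d x b)" for x
    by (auto simp: A_def dist_to_set_def)
  have A: "A k \<in> CL X d" for k
    using singleton_in_CL[OF assms(1)] ab by (simp add: A_def)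
  have "Wijsman_statistically_convergent X d A {b}"
    unfolding Wijsman_statistically_convergent_def dist
    by (intro ballI statistically_convergentI[OF E]) (simp add: dist_to_set_def)
  then have "A \<in> WS X d"
    using A singleton_in_CL[OF assms(1) ab(2)] by (auto simp: WS_def)
  then obtain B where "Wijsman_f_statistically_convergent X d f A B"
    unfolding assms(4) by (auto simp: WSf_def)
  \<comment> \<open>Testing at the point \<open>a\<close> separates the two values, 0 and
    \<open>d a b\<close>. The Wijsman limit \<open>B\<close> is unknown and may differ from
    \<open>{b}\<close>, so \<open>dist_to_set d a B\<close> is treated as an arbitrary real
    number.\<close>
  then have "f_statistically_convergent f (\<lambda>k. if k \<in> E then d a a else d a b) (dist_to_set d a B)"
    using ab(1) unfolding Wijsman_f_statistically_convergent_def dist by blast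
  moreover have "d a a \<noteq> d a b"
    using ab Metric_space.zero[OF assms(1)] by metis
  ultimately show False
    using not_f_statistically_convergent[OF f E fE] by blast
qed

end
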